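(* Let $\mathcal{E}$ be an exact category. For $i=1,2$, let $(\mathcal{T}_i,\mathcal{F}_i)$ be a torsion pair in $\mathcal{E}$, with $\mathcal{T}_1\subseteq\mathcal{T}_2$, and let $\mathcal{H}:=\mathcal{T}_2\cap\mathcal{F}_1$. Then there exist mutually inverse isomorphisms of posets $$\Phi:\mathsf{tors}[(\mathcal{T}_1,\mathcal{F}_1),(\mathcal{T}_2,\mathcal{F}_2)]\longrightarrow\mathsf{tors}\,\mathcal{H},\qquad\Psi:\mathsf{tors}\,\mathcal{H}\longrightarrow\mathsf{tors}[(\mathcal{T}_1,\mathcal{F}_1),(\mathcal{T}_2,\mathcal{F}_2)],$$ where $\Phi(\mathcal{T},\mathcal{F}):=(\mathcal{T}\cap\mathcal{F}_1,\ \mathcal{T}_2\cap\mathcal{F})$ and $\Psi(\mathcal{X},\mathcal{Y}):=(\mathcal{T}_1\ast\mathcal{X},\ \mathcal{Y}\ast\mathcal{F}_2)$.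
   Context: All categories are skeletally small; all subcategories are full and closed under isomorphisms. Exact categories are in the sense of Quillen. For subcategories $\mathcal{X},\mathcal{Y}$ of $\mathcal{E}$, $\mathcal{X}\ast\mathcal{Y}$ is the subcategory of objects $M\in\mathcal{E}$ admitting a conflation $0\to X\to M\to Y\to0$ with $X\in\mathcal{X}$, $Y\in\mathcal{Y}$. A torsion pair in $\mathcal{E}$ is a pair $(\mathcal{T},\mathcal{F})$ of subcategories with $\mathcal{E}=\mathcal{T}\ast\mathcal{F}$ and $\mathcal{E}(\mathcal{T},\mathcal{F})=0$. $\mathsf{tors}\,\mathcal{E}$ is the set of torsion pairs ordered by $(\mathcal{T}_1,\mathcal{F}_1)\le(\mathcal{T}_2,\mathcal{F}_2)$ iff $\mathcal{T}_1\subseteq\mathcal{T}_2$, and $\mathsf{tors}[(\mathcal{T}_1,\mathcal{F}_1),(\mathcal{T}_2,\mathcal{F}_2)]:=\{(\mathcal{T},\mathcal{F})\in\mathsf{tors}\,\mathcal{E}\mid\mathcal{T}_1\subseteq\mathcal{T}\subseteq\mathcal{T}_2\}$. The subcategory $\mathcal{H}$ is extension-closed in $\mathcal{E}$ and is regarded as an exact category whose conflations are the conflations of $\mathcal{E}$ with all three terms in $\mathcal{H}$. *)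

theory Defs
  imports "HOL-Algebra.Group"
begin

section \<open>Categories\<close>

text \<open>
  Categories have a set of objects and a set of arrows, each arrow carrying its domain and
  codomain. The composite \<open>g \<cdot> f\<close> means ``first \<open>f\<close>, then \<open>g\<close>''; it is only meaningful when
  the codomain of \<open>f\<close> is the domain of \<open>g\<close>.
\<close>

record ('o, 'm) category_data =
  Obj :: "'o set"
  Arr :: "'m set"
  Dom :: "'m \<Rightarrow> 'o"
  Cod :: "'m \<Rightarrow> 'o"
  Id :: "'o \<Rightarrow> 'm"
  Comp :: "'m \<Rightarrow> 'm \<Rightarrow> 'm"  (infixl \<open>\<cdot>\<index>\<close> 70)

definition Homs :: "('o, 'm, 'z) category_data_scheme \<Rightarrow> 'o \<Rightarrow> 'o \<Rightarrow> 'm set" where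
  "Homs C A B = {f \<in> Arr C. Dom C f = A \<and> Cod C f = B}"

locale category =
  fixes C :: "('o, 'm, 'z) category_data_scheme" (structure)
  assumes Dom_Obj: "f \<in> Arr C \<Longrightarrow> Dom C f \<in> Obj C"
    and Cod_Obj: "f \<in> Arr C \<Longrightarrow> Cod C f \<in> Obj C"
    and Id_Homs: "A \<in> Obj C \<Longrightarrow> Id C A \<in> Homs C A A"
    and Comp_Homs: "\<lbrakk>f \<in> Homs C A B; g \<in> Homs C B D\<rbrakk> \<Longrightarrow> g \<cdot> f \<in> Homs C A D"
    and Comp_Id_right: "f \<in> Homs C A B \<Longrightarrow> f \<cdot> Id C A = f"
    and Comp_Id_left: "f \<in> Homs C A B \<Longrightarrow> Id C B \<cdot> f = f"
    and Comp_assoc: "\<lbrakk>f \<in> Homs C A A'; g \<in> Homs C A' B; h \<in> Homs C B B'\<rbrakk>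
      \<Longrightarrow> h \<cdot> (g \<cdot> f) = (h \<cdot> g) \<cdot> f"

definition is_iso :: "('o, 'm, 'z) category_data_scheme \<Rightarrow> 'm \<Rightarrow> bool" where
  "is_iso C f \<longleftrightarrow> f \<in> Arr C \<and>
    (\<exists>g \<in> Homs C (Cod C f) (Dom C f).
      g \<cdot>\<^bsub>C\<^esub> f = Id C (Dom C f) \<and> f \<cdot>\<^bsub>C\<^esub> g = Id C (Cod C f))"

text \<open>A full subcategory closed under isomorphisms is given by its set of objects.\<close>

definition subcategory :: "('o, 'm, 'z) category_data_scheme \<Rightarrow> 'o set \<Rightarrow> bool" where
  "subcategory C S \<longleftrightarrow> S \<subseteq> Obj C \<and> (\<forall>f. is_iso C f \<and> Dom C f \<in> S \<longrightarrow> Cod C f \<in> S)"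

definition is_zero_object :: "('o, 'm, 'z) category_data_scheme \<Rightarrow> 'o \<Rightarrow> bool" where
  "is_zero_object C Z \<longleftrightarrow> Z \<in> Obj C \<and>
    (\<forall>A \<in> Obj C. (\<exists>!f. f \<in> Homs C A Z) \<and> (\<exists>!f. f \<in> Homs C Z A))"

definition is_pushout ::
  "('o, 'm, 'z) category_data_scheme \<Rightarrow> 'm \<Rightarrow> 'm \<Rightarrow> 'm \<Rightarrow> 'm \<Rightarrow> bool" where
  \<comment> \<open>the square \<open>i' \<cdot> f = f' \<cdot> i\<close>, with span \<open>(i, f)\<close> and cospan \<open>(i', f')\<close>\<close>
  "is_pushout C i f i' f' \<longleftrightarrow>
    i \<in> Arr C \<and> f \<in> Arr C \<and> i' \<in> Arr C \<and> f' \<in> Arr C \<and>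
    Dom C f = Dom C i \<and> Dom C i' = Cod C f \<and> Dom C f' = Cod C i \<and> Cod C i' = Cod C f' \<and>
    i' \<cdot>\<^bsub>C\<^esub> f = f' \<cdot>\<^bsub>C\<^esub> i \<and>
    (\<forall>X \<in> Obj C. \<forall>u \<in> Homs C (Cod C f) X. \<forall>v \<in> Homs C (Cod C i) X.
      u \<cdot>\<^bsub>C\<^esub> f = v \<cdot>\<^bsub>C\<^esub> i \<longrightarrow>
      (\<exists>!w. w \<in> Homs C (Cod C i') X \<and> w \<cdot>\<^bsub>C\<^esub> i' = u \<and> w \<cdot>\<^bsub>C\<^esub> f' = v))"

definition is_pullback ::
  "('o, 'm, 'z) category_data_scheme \<Rightarrow> 'm \<Rightarrow> 'm \<Rightarrow> 'm \<Rightarrow> 'm \<Rightarrow> bool" where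
  \<comment> \<open>the square \<open>f \<cdot> p' = p \<cdot> f'\<close>, with cospan \<open>(p, f)\<close> and span \<open>(p', f')\<close>\<close>
  "is_pullback C p f p' f' \<longleftrightarrow>
    p \<in> Arr C \<and> f \<in> Arr C \<and> p' \<in> Arr C \<and> f' \<in> Arr C \<and>
    Cod C f = Cod C p \<and> Cod C p' = Dom C f \<and> Cod C f' = Dom C p \<and> Dom C p' = Dom C f' \<and>
    f \<cdot>\<^bsub>C\<^esub> p' = p \<cdot>\<^bsub>C\<^esub> f' \<and>
    (\<forall>X \<in> Obj C. \<forall>u \<in> Homs C X (Dom C f). \<forall>v \<in> Homs C X (Dom C p).
      f \<cdot>\<^bsub>C\<^esub> u = p \<cdot>\<^bsub>C\<^esub> v \<longrightarrow>
      (\<exists>!w. w \<in> Homs C X (Dom C p') \<and> p' \<cdot>\<^bsub>C\<^esub> w = u \<and> f' \<cdot>\<^bsub>C\<^esub> w = v))"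

section \<open>Additive categories\<close>

text \<open>\<open>hzero C A B\<close> is the zero arrow from \<open>A\<close> to \<open>B\<close>.\<close>

record ('o, 'm) preadditive_data = "('o, 'm) category_data" +
  hadd :: "'m \<Rightarrow> 'm \<Rightarrow> 'm"  (infixl \<open>\<oplus>h\<index>\<close> 65)
  hzero :: "'o \<Rightarrow> 'o \<Rightarrow> 'm"

definition hom_group :: "('o, 'm, 'z) preadditive_data_scheme \<Rightarrow> 'o \<Rightarrow> 'o \<Rightarrow> 'm monoid" where
  "hom_group C A B = \<lparr>carrier = Homs C A B, mult = hadd C, one = hzero C A B\<rparr>"

definition is_biproduct ::
  "('o, 'm, 'z) preadditive_data_scheme \<Rightarrow> 'o \<Rightarrow> 'o \<Rightarrow> 'o \<Rightarrow> bool" where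
  "is_biproduct C A B P \<longleftrightarrow> P \<in> Obj C \<and>
    (\<exists>i \<in> Homs C A P. \<exists>j \<in> Homs C B P. \<exists>p \<in> Homs C P A. \<exists>q \<in> Homs C P B.
      p \<cdot>\<^bsub>C\<^esub> i = Id C A \<and> q \<cdot>\<^bsub>C\<^esub> j = Id C B \<and>
      q \<cdot>\<^bsub>C\<^esub> i = hzero C A B \<and> p \<cdot>\<^bsub>C\<^esub> j = hzero C B A \<and>
      (i \<cdot>\<^bsub>C\<^esub> p) \<oplus>h\<^bsub>C\<^esub> (j \<cdot>\<^bsub>C\<^esub> q) = Id C P)"

locale additive_category = category C
  for C :: "('o, 'm, 'z) preadditive_data_scheme" (structure) +
  assumes hom_group: "\<lbrakk>A \<in> Obj C; B \<in> Obj C\<rbrakk> \<Longrightarrow> comm_group (hom_group C A B)"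
    and Comp_add_right: "\<lbrakk>f \<in> Homs C A B; f' \<in> Homs C A B; g \<in> Homs C B D\<rbrakk>
      \<Longrightarrow> g \<cdot> (f \<oplus>h f') = (g \<cdot> f) \<oplus>h (g \<cdot> f')"
    and Comp_add_left: "\<lbrakk>f \<in> Homs C A B; g \<in> Homs C B D; g' \<in> Homs C B D\<rbrakk>
      \<Longrightarrow> (g \<oplus>h g') \<cdot> f = (g \<cdot> f) \<oplus>h (g' \<cdot> f)"
    and zero_object: "\<exists>Z. is_zero_object C Z"
    and biproduct: "\<lbrakk>A \<in> Obj C; B \<in> Obj C\<rbrakk> \<Longrightarrow> \<exists>P. is_biproduct C A B P"

definition is_kernel :: "('o, 'm, 'z) preadditive_data_scheme \<Rightarrow> 'm \<Rightarrow> 'm \<Rightarrow> bool" where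
  \<comment> \<open>\<open>i\<close> is a kernel of \<open>p\<close>\<close>
  "is_kernel C i p \<longleftrightarrow> i \<in> Arr C \<and> p \<in> Arr C \<and> Cod C i = Dom C p \<and>
    p \<cdot>\<^bsub>C\<^esub> i = hzero C (Dom C i) (Cod C p) \<and>
    (\<forall>X \<in> Obj C. \<forall>f \<in> Homs C X (Dom C p). p \<cdot>\<^bsub>C\<^esub> f = hzero C X (Cod C p) \<longrightarrow>
      (\<exists>!g. g \<in> Homs C X (Dom C i) \<and> i \<cdot>\<^bsub>C\<^esub> g = f))"

definition is_cokernel :: "('o, 'm, 'z) preadditive_data_scheme \<Rightarrow> 'm \<Rightarrow> 'm \<Rightarrow> bool" where
  \<comment> \<open>\<open>p\<close> is a cokernel of \<open>i\<close>\<close>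
  "is_cokernel C p i \<longleftrightarrow> p \<in> Arr C \<and> i \<in> Arr C \<and> Cod C i = Dom C p \<and>
    p \<cdot>\<^bsub>C\<^esub> i = hzero C (Dom C i) (Cod C p) \<and>
    (\<forall>X \<in> Obj C. \<forall>f \<in> Homs C (Cod C i) X. f \<cdot>\<^bsub>C\<^esub> i = hzero C (Dom C i) X \<longrightarrow>
      (\<exists>!g. g \<in> Homs C (Cod C p) X \<and> g \<cdot>\<^bsub>C\<^esub> p = f))"

section \<open>Exact categories\<close>

text \<open>A pair \<open>(i, p)\<close> in \<open>Confl\<close> stands for the conflation \<open>0 \<rightarrow> X -i\<rightarrow> M -p\<rightarrow> Y \<rightarrow> 0\<close>.\<close>

record ('o, 'm) exact_data = "('o, 'm) preadditive_data" +
  Confl :: "('m \<times> 'm) set"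

definition inflation :: "('o, 'm, 'z) exact_data_scheme \<Rightarrow> 'm \<Rightarrow> bool" where
  "inflation C i \<longleftrightarrow> (\<exists>p. (i, p) \<in> Confl C)"

definition deflation :: "('o, 'm, 'z) exact_data_scheme \<Rightarrow> 'm \<Rightarrow> bool" where
  "deflation C p \<longleftrightarrow> (\<exists>i. (i, p) \<in> Confl C)"

text \<open>
  These are Quillen's axioms in the standard reduced form (Keller; Buehler, \<^emph>\<open>Exact categories\<close>):
  Quillen's remaining axiom, on morphisms that have a kernel or a cokernel, follows from the ones
  below, and so does the fact that split sequences are conflations.
\<close>

locale exact_category = additive_category C
  for C :: "('o, 'm, 'z) exact_data_scheme" (structure) +
  assumes Confl_kernel: "(i, p) \<in> Confl C \<Longrightarrow> is_kernel C i p"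
    and Confl_cokernel: "(i, p) \<in> Confl C \<Longrightarrow> is_cokernel C p i"
    and Confl_iso: "\<lbrakk>(i, p) \<in> Confl C; i' \<in> Arr C; p' \<in> Arr C; Cod C i' = Dom C p';
        is_iso C a; is_iso C b; is_iso C c;
        a \<in> Homs C (Dom C i) (Dom C i'); b \<in> Homs C (Cod C i) (Cod C i');
        c \<in> Homs C (Cod C p) (Cod C p'); b \<cdot> i = i' \<cdot> a; c \<cdot> p = p' \<cdot> b\<rbrakk>
      \<Longrightarrow> (i', p') \<in> Confl C"
    and Id_inflation: "A \<in> Obj C \<Longrightarrow> inflation C (Id C A)"
    and Id_deflation: "A \<in> Obj C \<Longrightarrow> deflation C (Id C A)"
    and inflation_Comp: "\<lbrakk>inflation C i; inflation C j; Dom C j = Cod C i\<rbrakk> \<Longrightarrow> inflation C (j \<cdot> i)"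
    and deflation_Comp: "\<lbrakk>deflation C p; deflation C q; Dom C q = Cod C p\<rbrakk> \<Longrightarrow> deflation C (q \<cdot> p)"
    and inflation_pushout: "\<lbrakk>inflation C i; f \<in> Arr C; Dom C f = Dom C i\<rbrakk>
      \<Longrightarrow> \<exists>i' f'. is_pushout C i f i' f' \<and> inflation C i'"
    and deflation_pullback: "\<lbrakk>deflation C p; f \<in> Arr C; Cod C f = Cod C p\<rbrakk>
      \<Longrightarrow> \<exists>p' f'. is_pullback C p f p' f' \<and> deflation C p'"

definition extensions :: "('o, 'm, 'z) exact_data_scheme \<Rightarrow> 'o set \<Rightarrow> 'o set \<Rightarrow> 'o set"
  (infixl \<open>\<star>\<index>\<close> 65) where
  "\<X> \<star>\<^bsub>C\<^esub> \<Y> =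
    {M \<in> Obj C. \<exists>(i, p) \<in> Confl C. Dom C i \<in> \<X> \<and> Cod C i = M \<and> Dom C p = M \<and> Cod C p \<in> \<Y>}"

text \<open>
  The full subcategory on \<open>S\<close>, with those conflations of \<open>C\<close> all of whose terms lie in \<open>S\<close>.
  It is an exact category if \<open>S\<close> is an extension-closed subcategory containing a zero object.
\<close>

definition full_exact_subcategory ::
  "('o, 'm, 'z) exact_data_scheme \<Rightarrow> 'o set \<Rightarrow> ('o, 'm, 'z) exact_data_scheme" where
  "full_exact_subcategory C S = C
    \<lparr>Obj := S,
     Arr := {f \<in> Arr C. Dom C f \<in> S \<and> Cod C f \<in> S},
     Confl := {(i, p) \<in> Confl C. Dom C i \<in> S \<and> Cod C i \<in> S \<and> Cod C p \<in> S}\<rparr>"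

section \<open>Torsion pairs\<close>

definition torsion_pair :: "('o, 'm, 'z) exact_data_scheme \<Rightarrow> 'o set \<Rightarrow> 'o set \<Rightarrow> bool" where
  "torsion_pair C \<T> \<F> \<longleftrightarrow> subcategory C \<T> \<and> subcategory C \<F> \<and>
    Obj C = \<T> \<star>\<^bsub>C\<^esub> \<F> \<and> (\<forall>A \<in> \<T>. \<forall>B \<in> \<F>. Homs C A B = {hzero C A B})"

definition tors :: "('o, 'm, 'z) exact_data_scheme \<Rightarrow> ('o set \<times> 'o set) gorder" where
  "tors C = \<lparr>carrier = {(\<T>, \<F>). torsion_pair C \<T> \<F>}, eq = (=), le = (\<lambda>x y. fst x \<subseteq> fst y)\<rparr>"

definition tors_interval ::
  "('o, 'm, 'z) exact_data_scheme \<Rightarrow> 'o set \<times> 'o set \<Rightarrow> 'o set \<times> 'o set \<Rightarrow>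
    ('o set \<times> 'o set) gorder" where
  "tors_interval C x y = (tors C)
    \<lparr>carrier := {z \<in> carrier (tors C). fst x \<subseteq> fst z \<and> fst z \<subseteq> fst y}\<rparr>"

definition poset_isomorphism ::
  "('a, 'c) gorder_scheme \<Rightarrow> ('b, 'd) gorder_scheme \<Rightarrow> ('a \<Rightarrow> 'b) \<Rightarrow> bool" where
  "poset_isomorphism P Q f \<longleftrightarrow> partial_order P \<and> partial_order Q \<and>
    bij_betw f (carrier P) (carrier Q) \<and>
    (\<forall>x \<in> carrier P. \<forall>y \<in> carrier P. x \<sqsubseteq>\<^bsub>P\<^esub> y \<longleftrightarrow> f x \<sqsubseteq>\<^bsub>Q\<^esub> f y)"

end

(* By associativity of the extension product, E = (T1 * (X * Y)) * F2 can be rebracketed as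
   (T1 * X) * (Y * F2), which makes Psi well defined; everything else follows from the fact that
   each half of a torsion pair is the orthogonal of the other. Torsion and torsion-free classes are
   exchanged by passing to the opposite exact category, so half of each argument is obtained by
   duality. *)
theory Submission
  imports Defs
begin

section \<open>The opposite exact category\<close>

text \<open>The rebracketing starts from \<open>\<T>\<^sub>2 \<subseteq> \<T>\<^sub>1 \<star>
  (\<T>\<^sub>2 \<inter> \<F>\<^sub>1)\<close>: for \<open>M\<close> in \<open>\<T>\<^sub>2\<close>,
  the torsion-free quotient with respect to the first pair is still orthogonal to
  \<open>\<F>\<^sub>2\<close>, so it lies in the heart, which is contained in
  \<open>\<X> \<star> \<Y>\<close>. The obstacle is associativity straight from the reduced axioms.
  No isomorphism theorem is established; instead a pullback along a deflation is compared with a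
  kernel given by a conflation. Such a comparison identifies objects only up to isomorphism, and
  this is where closure of the classes under isomorphisms enters.\<close>

definition opposite :: "('o, 'm, 'z) exact_data_scheme \<Rightarrow> ('o, 'm, 'z) exact_data_scheme" where
  "opposite C = C\<lparr>Dom := Cod C, Cod := Dom C, Comp := (\<lambda>g f. f \<cdot>\<^bsub>C\<^esub> g),
     hzero := (\<lambda>A B. hzero C B A), Confl := (Confl C)\<inverse>\<rparr>"

lemma opposite_simps [simp]:
  "Obj (opposite C) = Obj C" "Arr (opposite C) = Arr C"
  "Dom (opposite C) = Cod C" "Cod (opposite C) = Dom C"
  "Id (opposite C) = Id C" "g \<cdot>\<^bsub>opposite C\<^esub> f = f \<cdot>\<^bsub>C\<^esub> g"
  "hadd (opposite C) = hadd C" "hzero (opposite C) A B = hzero C B A"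
  "Confl (opposite C) = (Confl C)\<inverse>"
  by (simp_all add: opposite_def)

lemma Homs_opposite [simp]: "Homs (opposite C) A B = Homs C B A"
  by (auto simp: Homs_def)

lemma is_iso_opposite [simp]: "is_iso (opposite C) f = is_iso C f"
  by (auto simp: is_iso_def)

text \<open>Reversing arrows exchanges source and target of an isomorphism, so closure in one
  category translates into closure in the other by passing to the inverse.\<close>

lemma subcategory_opposite [simp]: "subcategory (opposite C) S = subcategory C S"
proof -
  have "\<exists>g. is_iso C g \<and> Dom C g = Cod C f \<and> Cod C g = Dom C f" if iso: "is_iso C f" for f
  proof -
    obtain g where "g \<in> Homs C (Cod C f) (Dom C f)" "g \<cdot>\<^bsub>C\<^esub> f = Id C (Dom C f)"
        "f \<cdot>\<^bsub>C\<^esub> g = Id C (Cod C f)"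
      using iso unfolding is_iso_def by blast
    then have "is_iso C g \<and> Dom C g = Cod C f \<and> Cod C g = Dom C f"
      using iso unfolding is_iso_def Homs_def by auto
    then show ?thesis ..
  qed
  then show ?thesis
    unfolding subcategory_def by simp metis
qed

lemma extensions_opposite [simp]: "\<X> \<star>\<^bsub>opposite C\<^esub> \<Y> = \<Y> \<star>\<^bsub>C\<^esub> \<X>"
  by (auto simp: extensions_def)

lemma is_kernel_opposite [simp]: "is_kernel (opposite C) i p = is_cokernel C i p"
  by (auto simp: is_kernel_def is_cokernel_def)

lemma is_cokernel_opposite [simp]: "is_cokernel (opposite C) p i = is_kernel C p i"
  by (auto simp: is_kernel_def is_cokernel_def)

lemma is_pushout_opposite [simp]: "is_pushout (opposite C) i f i' f' = is_pullback C i f i' f'"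
  unfolding is_pushout_def is_pullback_def by (simp add: conj_ac eq_commute)

lemma is_pullback_opposite [simp]: "is_pullback (opposite C) i f i' f' = is_pushout C i f i' f'"
  unfolding is_pushout_def is_pullback_def by (simp add: conj_ac eq_commute)

lemma inflation_opposite [simp]: "inflation (opposite C) i = deflation C i"
  by (simp add: inflation_def deflation_def)

lemma deflation_opposite [simp]: "deflation (opposite C) i = inflation C i"
  by (simp add: inflation_def deflation_def)

lemma is_zero_object_opposite [simp]: "is_zero_object (opposite C) Z = is_zero_object C Z"
  by (auto simp: is_zero_object_def)

lemma is_biproduct_opposite: "is_biproduct C A B P \<Longrightarrow> is_biproduct (opposite C) A B P"
  unfolding is_biproduct_def by simp blast

lemma hom_group_opposite [simp]: "hom_group (opposite C) A B = hom_group C B A"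
  by (simp add: hom_group_def)

text \<open>The axioms on inflations and pushouts are exchanged with those on deflations and
  pullbacks. The laborious one is closure of conflations under isomorphism, because the given
  isomorphisms change direction.\<close>

lemma exact_category_opposite:
  assumes "exact_category C"
  shows "exact_category (opposite C)"
proof -
  interpret exact_category C by fact
  show ?thesis
  proof (intro exact_category.intro additive_category.intro category.intro
      exact_category_axioms.intro additive_category_axioms.intro)
    show "\<exists>P. is_biproduct (opposite C) A B P"
      if "A \<in> Obj (opposite C)" "B \<in> Obj (opposite C)" for A B
      using biproduct that is_biproduct_opposite by fastforce
  next
    fix i p i' p' a b c
    assume ip: "(i, p) \<in> Confl (opposite C)"
      and arr: "i' \<in> Arr (opposite C)" "p' \<in> Arr (opposite C)"
        "Cod (opposite C) i' = Dom (opposite C) p'"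
      and iso: "is_iso (opposite C) a" "is_iso (opposite C) b" "is_iso (opposite C) c"
      and a: "a \<in> Homs (opposite C) (Dom (opposite C) i) (Dom (opposite C) i')"
      and b: "b \<in> Homs (opposite C) (Cod (opposite C) i) (Cod (opposite C) i')"
      and c: "c \<in> Homs (opposite C) (Cod (opposite C) p) (Cod (opposite C) p')"
      and eq: "b \<cdot>\<^bsub>opposite C\<^esub> i = i' \<cdot>\<^bsub>opposite C\<^esub> a" "c \<cdot>\<^bsub>opposite C\<^esub> p = p' \<cdot>\<^bsub>opposite C\<^esub> b"
    \<comment> \<open>Read in \<open>C\<close>, the arrows \<open>a\<close>, \<open>b\<close>,
      \<open>c\<close> run from the new conflation to the old one. \<open>Confl_iso\<close> wants
      the other direction, so their inverses are used and the two squares rewritten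
      accordingly.\<close>
    obtain a' where a': "a' \<in> Homs C (Cod C i) (Cod C i')" "a' \<cdot>\<^bsub>C\<^esub> a = Id C (Cod C i')"
        "a \<cdot>\<^bsub>C\<^esub> a' = Id C (Cod C i)"
      using iso(1) a unfolding is_iso_def Homs_def by auto
    obtain b' where b': "b' \<in> Homs C (Dom C i) (Dom C i')" "b' \<cdot>\<^bsub>C\<^esub> b = Id C (Dom C i')"
        "b \<cdot>\<^bsub>C\<^esub> b' = Id C (Dom C i)"
      using iso(2) b unfolding is_iso_def Homs_def by auto
    obtain c' where c': "c' \<in> Homs C (Dom C p) (Dom C p')" "c' \<cdot>\<^bsub>C\<^esub> c = Id C (Dom C p')"
        "c \<cdot>\<^bsub>C\<^esub> c' = Id C (Dom C p)"
      using iso(3) c unfolding is_iso_def Homs_def by auto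
    have iso': "is_iso C a'" "is_iso C b'" "is_iso C c'"
      using a a' b b' c c' unfolding is_iso_def Homs_def by auto
    have conf: "(p, i) \<in> Confl C" using ip by simp
    have i: "i \<in> Homs C (Dom C i) (Cod C i)" and p: "p \<in> Homs C (Dom C p) (Dom C i)"
      using Confl_kernel[OF conf] unfolding is_kernel_def Homs_def by auto
    have i': "i' \<in> Homs C (Dom C i') (Cod C i')" and p': "p' \<in> Homs C (Dom C p') (Dom C i')"
      using arr unfolding Homs_def by auto
    have ba: "i \<cdot>\<^bsub>C\<^esub> b = a \<cdot>\<^bsub>C\<^esub> i'" and cb: "p \<cdot>\<^bsub>C\<^esub> c = b \<cdot>\<^bsub>C\<^esub> p'" using eq by simp_all
    have aH: "a \<in> Homs C (Cod C i') (Cod C i)" and bH: "b \<in> Homs C (Dom C i') (Dom C i)"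
      and cH: "c \<in> Homs C (Dom C p') (Dom C p)"
      using a b c iso p p' by (simp_all add: Homs_def)
    have "a' \<cdot>\<^bsub>C\<^esub> i = (a' \<cdot>\<^bsub>C\<^esub> i) \<cdot>\<^bsub>C\<^esub> (b \<cdot>\<^bsub>C\<^esub> b')"
      using Comp_Id_right[OF Comp_Homs[OF i a'(1)]] b'(3) by simp
    also have "\<dots> = (a' \<cdot>\<^bsub>C\<^esub> (i \<cdot>\<^bsub>C\<^esub> b)) \<cdot>\<^bsub>C\<^esub> b'"
      using Comp_assoc[OF b'(1) bH Comp_Homs[OF i a'(1)]] Comp_assoc[OF bH i a'(1)] by simp
    also have "\<dots> = ((a' \<cdot>\<^bsub>C\<^esub> a) \<cdot>\<^bsub>C\<^esub> i') \<cdot>\<^bsub>C\<^esub> b'"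
      using Comp_assoc[OF i' aH a'(1)] ba by simp
    finally have 1: "a' \<cdot>\<^bsub>C\<^esub> i = i' \<cdot>\<^bsub>C\<^esub> b'" using a'(2) Comp_Id_left[OF i'] by simp
    have "b' \<cdot>\<^bsub>C\<^esub> p = (b' \<cdot>\<^bsub>C\<^esub> p) \<cdot>\<^bsub>C\<^esub> (c \<cdot>\<^bsub>C\<^esub> c')"
      using Comp_Id_right[OF Comp_Homs[OF p b'(1)]] c'(3) by simp
    also have "\<dots> = (b' \<cdot>\<^bsub>C\<^esub> (p \<cdot>\<^bsub>C\<^esub> c)) \<cdot>\<^bsub>C\<^esub> c'"
      using Comp_assoc[OF c'(1) cH Comp_Homs[OF p b'(1)]] Comp_assoc[OF cH p b'(1)] by simp
    also have "\<dots> = ((b' \<cdot>\<^bsub>C\<^esub> b) \<cdot>\<^bsub>C\<^esub> p') \<cdot>\<^bsub>C\<^esub> c'"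
      using Comp_assoc[OF p' bH b'(1)] cb by simp
    finally have 2: "b' \<cdot>\<^bsub>C\<^esub> p = p' \<cdot>\<^bsub>C\<^esub> c'" using b'(2) Comp_Id_left[OF p'] by simp
    have "Cod C p = Dom C i" using p by (simp add: Homs_def)
    moreover have "Cod C p' = Dom C i'" using arr by simp
    ultimately have "(p', i') \<in> Confl C"
      using Confl_iso[OF conf _ _ _ iso'(3,2,1) c'(1)] arr a'(1) b'(1) 1 2 by simp
    then show "(i', p') \<in> Confl (opposite C)" by simp
  qed (simp_all add: Dom_Obj Cod_Obj Id_Homs Comp_Homs Comp_Id_right Comp_Id_left Comp_assoc
      hom_group Comp_add_right Comp_add_left zero_object Confl_kernel Confl_cokernel Id_inflation
      Id_deflation inflation_Comp deflation_Comp, (metis inflation_pushout deflation_pullback)+)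
qed


section \<open>Conflations and extensions\<close>

lemma subcategory_closed:
  assumes "subcategory C S" "f \<in> Homs C A B" "g \<in> Homs C B A"
    and "g \<cdot>\<^bsub>C\<^esub> f = Id C A" "f \<cdot>\<^bsub>C\<^esub> g = Id C B" "A \<in> S"
  shows "B \<in> S"
proof -
  have "is_iso C f" "Dom C f = A" "Cod C f = B"
    using assms unfolding is_iso_def Homs_def by auto
  then show ?thesis using assms unfolding subcategory_def by auto
qed

section \<open>Zero arrows and composition\<close>

context additive_category
begin

lemma HomsD: "f \<in> Homs C A B \<Longrightarrow> A \<in> Obj C" "f \<in> Homs C A B \<Longrightarrow> B \<in> Obj C"
  using Dom_Obj Cod_Obj by (auto simp: Homs_def)

lemma hzero_Homs: "\<lbrakk>A \<in> Obj C; B \<in> Obj C\<rbrakk> \<Longrightarrow> hzero C A B \<in> Homs C A B"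
  using monoid.one_closed[of "hom_group C A B"] hom_group[of A B]
  by (simp add: comm_group_def group_def hom_group_def)

lemma hadd_hzero: "\<lbrakk>A \<in> Obj C; B \<in> Obj C\<rbrakk> \<Longrightarrow> hzero C A B \<oplus>h hzero C A B = hzero C A B"
  using monoid.l_one[of "hom_group C A B" "hzero C A B"] hom_group[of A B] hzero_Homs[of A B]
  by (simp add: comm_group_def group_def hom_group_def)

text \<open>An idempotent element of a group is neutral. Bilinearity makes a composite with a zero
  arrow idempotent, which is how the two lemmas on such composites use this.\<close>

lemma eq_hzeroI:
  assumes "f \<in> Homs C A B" "f \<oplus>h f = f"
  shows "f = hzero C A B"
proof -
  interpret comm_group "hom_group C A B" using hom_group HomsD[OF assms(1)] by blast
  show ?thesis using l_cancel_one[of f f] assms by (simp add: hom_group_def)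
qed

lemma Comp_hzero_right:
  assumes "g \<in> Homs C B D" "A \<in> Obj C"
  shows "g \<cdot> hzero C A B = hzero C A D"
proof (rule eq_hzeroI)
  note z = hzero_Homs[OF assms(2) HomsD(1)[OF assms(1)]]
  show "g \<cdot> hzero C A B \<in> Homs C A D" using z assms(1) Comp_Homs by blast
  show "(g \<cdot> hzero C A B) \<oplus>h (g \<cdot> hzero C A B) = g \<cdot> hzero C A B"
    using Comp_add_right[OF z z assms(1)] hadd_hzero[OF assms(2) HomsD(1)[OF assms(1)]] by simp
qed

lemma Comp_hzero_left:
  assumes "f \<in> Homs C A B" "D \<in> Obj C"
  shows "hzero C B D \<cdot> f = hzero C A D"
proof (rule eq_hzeroI)
  note z = hzero_Homs[OF HomsD(2)[OF assms(1)] assms(2)]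
  show "hzero C B D \<cdot> f \<in> Homs C A D" using z assms(1) Comp_Homs by blast
  show "(hzero C B D \<cdot> f) \<oplus>h (hzero C B D \<cdot> f) = hzero C B D \<cdot> f"
    using Comp_add_left[OF assms(1) z z] hadd_hzero[OF HomsD(2)[OF assms(1)] assms(2)] by simp
qed

lemma Homs_zeroI:
  assumes "A \<in> Obj C" "B \<in> Obj C" "\<And>f. f \<in> Homs C A B \<Longrightarrow> f = hzero C A B"
  shows "Homs C A B = {hzero C A B}"
  using assms hzero_Homs by blast

end

context exact_category
begin

text \<open>Membership in \<open>Confl\<close> carries no typing by itself; the kernel property
  supplies that \<open>i\<close> and \<open>p\<close> are arrows.\<close>

lemma extensions_iff:
  "M \<in> \<X> \<star> \<Y> \<longleftrightarrow>
    (\<exists>A \<in> \<X>. \<exists>B \<in> \<Y>. \<exists>i p. (i, p) \<in> Confl C \<and> i \<in> Homs C A M \<and> p \<in> Homs C M B)"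
proof
  assume "M \<in> \<X> \<star> \<Y>"
  then obtain i p where "(i, p) \<in> Confl C" "Dom C i \<in> \<X>" "Cod C i = M" "Dom C p = M" "Cod C p \<in> \<Y>"
    unfolding extensions_def by auto
  moreover from this have "i \<in> Homs C (Dom C i) M" "p \<in> Homs C M (Cod C p)"
    using Confl_kernel unfolding is_kernel_def Homs_def by auto
  ultimately show "\<exists>A \<in> \<X>. \<exists>B \<in> \<Y>. \<exists>i p. (i, p) \<in> Confl C \<and> i \<in> Homs C A M \<and> p \<in> Homs C M B"
    by blast
qed (use HomsD in \<open>fastforce simp: extensions_def Homs_def\<close>)

lemma extensionsE:
  assumes "M \<in> \<X> \<star> \<Y>"
  obtains A B i p where "A \<in> \<X>" "B \<in> \<Y>" "(i, p) \<in> Confl C" "i \<in> Homs C A M" "p \<in> Homs C M B"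
  using assms extensions_iff by blast

lemma extensions_mono: "\<lbrakk>\<X> \<subseteq> \<X>'; \<Y> \<subseteq> \<Y>'\<rbrakk> \<Longrightarrow> \<X> \<star> \<Y> \<subseteq> \<X>' \<star> \<Y>'"
  by (auto simp: extensions_def)

section \<open>Universal properties of the two maps of a conflation\<close>

lemma Confl_inflationE:
  assumes "(i, p) \<in> Confl C" "p \<in> Homs C M B"
  obtains A where "i \<in> Homs C A M"
  using Confl_kernel[OF assms(1)] assms(2) unfolding is_kernel_def Homs_def by auto

lemma Confl_deflationE:
  assumes "(i, p) \<in> Confl C" "i \<in> Homs C A M"
  obtains B where "p \<in> Homs C M B"
  using Confl_kernel[OF assms(1)] assms(2) unfolding is_kernel_def Homs_def by auto

lemma Confl_Comp:
  assumes "(i, p) \<in> Confl C" "i \<in> Homs C A M" "p \<in> Homs C M B"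
  shows "p \<cdot> i = hzero C A B"
  using Confl_kernel[OF assms(1)] assms(2,3) unfolding is_kernel_def Homs_def by auto

lemma Confl_lift:
  assumes "(i, p) \<in> Confl C" "i \<in> Homs C A M" "p \<in> Homs C M B"
    and "f \<in> Homs C X M" "p \<cdot> f = hzero C X B"
  obtains g where "g \<in> Homs C X A" "i \<cdot> g = f"
proof -
  have "Dom C i = A" "Dom C p = M" "Cod C p = B" using assms(2,3) by (auto simp: Homs_def)
  then show thesis
    using Confl_kernel[OF assms(1)] assms(4,5) HomsD(1)[OF assms(4)] that
    unfolding is_kernel_def by blast
qed

text \<open>The arrow \<open>i \<cdot> g\<close> is killed by \<open>p\<close>, so its factorization
  through the kernel \<open>i\<close> is unique, and both \<open>f\<close> and \<open>g\<close>
  provide one.\<close>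

lemma Confl_mono:
  assumes "(i, p) \<in> Confl C" "i \<in> Homs C A M"
    and "f \<in> Homs C X A" "g \<in> Homs C X A" "i \<cdot> f = i \<cdot> g"
  shows "f = g"
proof -
  obtain B where p: "p \<in> Homs C M B"
    using Confl_deflationE[OF assms(1,2)] .
  have "p \<cdot> (i \<cdot> g) = hzero C X B"
    using Confl_Comp[OF assms(1,2) p] Comp_assoc[OF assms(4,2) p]
      Comp_hzero_left[OF assms(4) HomsD(2)[OF p]] by simp
  then have "\<exists>!h. h \<in> Homs C X A \<and> i \<cdot> h = i \<cdot> g"
    using Confl_kernel[OF assms(1)] assms(2) p HomsD(1)[OF assms(3)] Comp_Homs[OF assms(4,2)]
    unfolding is_kernel_def by (auto simp: Homs_def)
  then show ?thesis using assms by auto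
qed

lemma exact_opposite: "exact_category (opposite C)"
  using exact_category_axioms exact_category_opposite by blast

lemma Confl_colift:
  assumes "(i, p) \<in> Confl C" "i \<in> Homs C A M" "p \<in> Homs C M B"
    and "f \<in> Homs C M X" "f \<cdot> i = hzero C A X"
  obtains g where "g \<in> Homs C B X" "g \<cdot> p = f"
  using exact_category.Confl_lift[OF exact_opposite, of p i B M A f X] assms by auto

lemma Confl_epi:
  assumes "(i, p) \<in> Confl C" "p \<in> Homs C M B"
    and "f \<in> Homs C B X" "g \<in> Homs C B X" "f \<cdot> p = g \<cdot> p"
  shows "f = g"
  using exact_category.Confl_mono[OF exact_opposite, of p i B M f X g] assms by auto

text \<open>
  The map \<open>j\<close> is a second kernel of \<open>p\<close> that is not known to be an inflation.
\<close>

lemma kernel_object_closed: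
  assumes "subcategory C S" "(i, p) \<in> Confl C" "i \<in> Homs C A M" "p \<in> Homs C M B"
    and "j \<in> Homs C A' M" "p \<cdot> j = hzero C A' B"
    and univ: "\<And>X f. \<lbrakk>f \<in> Homs C X M; p \<cdot> f = hzero C X B\<rbrakk> \<Longrightarrow> \<exists>!g. g \<in> Homs C X A' \<and> j \<cdot> g = f"
    and "A' \<in> S"
  shows "A \<in> S"
proof -
  obtain g where g: "g \<in> Homs C A' A" "i \<cdot> g = j" using Confl_lift[OF assms(2-6)] by blast
  obtain h where h: "h \<in> Homs C A A'" "j \<cdot> h = i"
    using univ[OF assms(3) Confl_Comp[OF assms(2-4)]] by blast
  have "i \<cdot> (g \<cdot> h) = i \<cdot> Id C A"
    using Comp_assoc[OF h(1) g(1) assms(3)] g h Comp_Id_right[OF assms(3)] by simp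
  then have 1: "g \<cdot> h = Id C A"
    using Confl_mono[OF assms(2,3) Comp_Homs[OF h(1) g(1)] Id_Homs] HomsD(1)[OF assms(3)] by blast
  have "j \<cdot> (h \<cdot> g) = j" "j \<cdot> Id C A' = j"
    using Comp_assoc[OF g(1) h(1) assms(5)] g h Comp_Id_right[OF assms(5)] by simp_all
  then have 2: "h \<cdot> g = Id C A'"
    using univ[OF assms(5,6)] Comp_Homs[OF g(1) h(1)] Id_Homs[OF HomsD(1)[OF assms(5)]] by blast
  show ?thesis using subcategory_closed[OF assms(1) g(1) h(1) 2 1 assms(8)] .
qed

lemma subcategory_Int: "\<lbrakk>subcategory C S; subcategory C T\<rbrakk> \<Longrightarrow> subcategory C (S \<inter> T)"
  unfolding subcategory_def by auto

lemma is_iso_Id: "A \<in> Obj C \<Longrightarrow> is_iso C (Id C A)"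
  using Id_Homs[of A] Comp_Id_left[OF Id_Homs[of A]] unfolding is_iso_def Homs_def by auto

text \<open>Given \<open>f\<close> from \<open>M\<close> to \<open>N\<close> with inverse
  \<open>g\<close>, the triple of isomorphisms \<open>Id\<close>, \<open>f\<close>,
  \<open>Id\<close> carries the conflation \<open>(i, p)\<close> to
  \<open>(f \<cdot> i, p \<cdot> g)\<close>, with the same end terms.\<close>

lemma subcategory_extensions: "subcategory C (\<X> \<star> \<Y>)"
  unfolding subcategory_def
proof safe
  fix M assume "M \<in> \<X> \<star> \<Y>" then show "M \<in> Obj C" by (simp add: extensions_def)
next
  fix f assume iso: "is_iso C f" and "Dom C f \<in> \<X> \<star> \<Y>"
  then obtain A B i p where AB: "A \<in> \<X>" "B \<in> \<Y>" and ip: "(i, p) \<in> Confl C"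
    and i: "i \<in> Homs C A (Dom C f)" and p: "p \<in> Homs C (Dom C f) B" by (elim extensionsE)
  define N where "N = Cod C f"
  obtain g where f: "f \<in> Homs C (Dom C f) N" and g: "g \<in> Homs C N (Dom C f)"
    and gf: "g \<cdot> f = Id C (Dom C f)"
    using iso unfolding is_iso_def N_def Homs_def by auto
  note fi = Comp_Homs[OF i f] and pg = Comp_Homs[OF g p]
  have "Id C B \<cdot> p = (p \<cdot> g) \<cdot> f" "f \<cdot> i = (f \<cdot> i) \<cdot> Id C A"
    using Comp_assoc[OF f g p] gf Comp_Id_left[OF p] Comp_Id_right[OF p] Comp_Id_right[OF fi]
    by simp_all
  moreover have "Dom C i = A" "Dom C (f \<cdot> i) = A" "Cod C i = Dom C f" "Cod C (f \<cdot> i) = N"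
    "Cod C p = B" "Cod C (p \<cdot> g) = B" "Dom C (p \<cdot> g) = N" "f \<cdot> i \<in> Arr C" "p \<cdot> g \<in> Arr C"
    using i p fi pg by (auto simp: Homs_def)
  ultimately have "(f \<cdot> i, p \<cdot> g) \<in> Confl C"
    using Confl_iso[OF ip _ _ _ is_iso_Id[OF HomsD(1)[OF i]] iso is_iso_Id[OF HomsD(2)[OF p]],
        of "f \<cdot> i" "p \<cdot> g"] f Id_Homs[OF HomsD(1)[OF i]] Id_Homs[OF HomsD(2)[OF p]]
    by simp
  then show "Cod C f \<in> \<X> \<star> \<Y>" using AB fi pg N_def extensions_iff by blast
qed

text \<open>Think of \<open>A\<close> as a subobject of \<open>M\<close> with quotient
  \<open>N\<close>, and of \<open>B\<close> as a subobject of \<open>N\<close>. The preimage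
  \<open>P\<close> of \<open>B\<close> in \<open>M\<close> is an extension of \<open>B\<close> by
  \<open>A\<close>, and it is the kernel of the composite deflation from \<open>M\<close> to
  \<open>D\<close>.\<close>

lemma extensions_assoc_subset:
  assumes "subcategory C \<X>"
  shows "\<X> \<star> (\<Y> \<star> \<Z>) \<subseteq> (\<X> \<star> \<Y>) \<star> \<Z>"
proof
  fix M assume "M \<in> \<X> \<star> (\<Y> \<star> \<Z>)"
  then obtain A N i d where A: "A \<in> \<X>" and "N \<in> \<Y> \<star> \<Z>" and id: "(i, d) \<in> Confl C"
    and i: "i \<in> Homs C A M" and d: "d \<in> Homs C M N" by (erule extensionsE)
  from \<open>N \<in> \<Y> \<star> \<Z>\<close> obtain B D j e where B: "B \<in> \<Y>" and D: "D \<in> \<Z>" and je: "(j, e) \<in> Confl C"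
    and j: "j \<in> Homs C B N" and e: "e \<in> Homs C N D" by (erule extensionsE)
  note ed = Comp_Homs[OF d e]
  have DObj: "D \<in> Obj C" using HomsD(2)[OF e] .
  have "deflation C (e \<cdot> d)"
    using deflation_Comp id je d e unfolding deflation_def Homs_def by auto
  then obtain k where ked: "(k, e \<cdot> d) \<in> Confl C" unfolding deflation_def by blast
  obtain K where k: "k \<in> Homs C K M"
    using Confl_inflationE[OF ked ed] .
  \<comment> \<open>The pullback of \<open>j\<close> along \<open>d\<close> is the preimage of
    \<open>B\<close>. The axiom makes \<open>p'\<close> a deflation but says nothing about
    \<open>f'\<close>, so \<open>f'\<close> has to be recognized as a kernel by hand.\<close>
  obtain p' f' where pb: "is_pullback C d j p' f'" and "deflation C p'"
    using deflation_pullback[of d j] id j d unfolding deflation_def Homs_def by auto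
  then obtain l where lp: "(l, p') \<in> Confl C" unfolding deflation_def by blast
  define P where "P = Dom C p'"
  have p': "p' \<in> Homs C P B" and f': "f' \<in> Homs C P M" and sq: "j \<cdot> p' = d \<cdot> f'"
    using pb j d unfolding is_pullback_def P_def Homs_def by auto
  obtain L where l: "l \<in> Homs C L P"
    using Confl_inflationE[OF lp p'] .
  have univ: "\<exists>!w. w \<in> Homs C X P \<and> p' \<cdot> w = u \<and> f' \<cdot> w = v"
    if "u \<in> Homs C X B" "v \<in> Homs C X M" "j \<cdot> u = d \<cdot> v" for X u v
  proof -
    have "Dom C j = B" "Dom C d = M" using j d by (simp_all add: Homs_def)
    then show ?thesis using pb that HomsD(1)[OF that(1)] unfolding is_pullback_def P_def by blast
  qed
  have jz: "j \<cdot> hzero C X B = hzero C X N" if "X \<in> Obj C" for X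
    using Comp_hzero_right[OF j that] .
  have "P \<in> \<X> \<star> \<Y>"
  proof -
    have AObj: "A \<in> Obj C" and BObj: "B \<in> Obj C" using HomsD i j by blast+
    \<comment> \<open>The zero arrow to \<open>B\<close> and \<open>i\<close> agree over
      \<open>N\<close>. The arrow \<open>w\<close> they induce is a second kernel of
      \<open>p'\<close>, with source \<open>A\<close>, so \<open>L\<close> is isomorphic to
      \<open>A\<close>.\<close>
    have "j \<cdot> hzero C A B = d \<cdot> i" using jz[OF AObj] Confl_Comp[OF id i d] by simp
    then obtain w where w: "w \<in> Homs C A P" "p' \<cdot> w = hzero C A B" "f' \<cdot> w = i"
      using univ[OF hzero_Homs[OF AObj BObj] i] by blast
    have "L \<in> \<X>"
    proof (rule kernel_object_closed[OF assms lp l p' w(1,2) _ A])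
      fix X f assume f: "f \<in> Homs C X P" and pf: "p' \<cdot> f = hzero C X B"
      have X: "X \<in> Obj C" using HomsD f by blast
      have f'f: "f' \<cdot> f \<in> Homs C X M" using Comp_Homs[OF f f'] .
      have jd: "j \<cdot> hzero C X B = d \<cdot> (f' \<cdot> f)"
        using Comp_assoc[OF f f' d] Comp_assoc[OF f p' j] sq pf by simp
      then obtain g where g: "g \<in> Homs C X A" "i \<cdot> g = f' \<cdot> f"
        using Confl_lift[OF id i d f'f] jz[OF X] by metis
      have "p' \<cdot> (w \<cdot> g) = hzero C X B" "f' \<cdot> (w \<cdot> g) = f' \<cdot> f"
        using Comp_assoc[OF g(1) w(1) p'] Comp_assoc[OF g(1) w(1) f'] w g
          Comp_hzero_left[OF g(1) BObj] by simp_all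
      then have "w \<cdot> g = f"
        using univ[OF hzero_Homs[OF X BObj] f'f jd] pf f Comp_Homs[OF g(1) w(1)] by blast
      \<comment> \<open>Uniqueness comes from \<open>f' \<cdot> w = i\<close>: since
        \<open>i\<close> is monic, so is \<open>w\<close>.\<close>
      moreover have "g' = g" if "g' \<in> Homs C X A" "w \<cdot> g' = f" for g'
        using Confl_mono[OF id i that(1) g(1)] Comp_assoc[OF that(1) w(1) f'] w(3) g(2) that(2)
        by simp
      ultimately show "\<exists>!g. g \<in> Homs C X A \<and> w \<cdot> g = f" using g(1) by blast
    qed
    then show ?thesis using lp l p' B extensions_iff by blast
  qed
  have "K \<in> \<X> \<star> \<Y>"
  proof (rule kernel_object_closed[OF subcategory_extensions ked k ed f' _ _ \<open>P \<in> \<X> \<star> \<Y>\<close>])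
    show "e \<cdot> d \<cdot> f' = hzero C P D"
      using Comp_assoc[OF f' d e] Comp_assoc[OF p' j e] sq Confl_Comp[OF je j e]
        Comp_hzero_left[OF p' DObj] by simp
  next
    fix X v assume v: "v \<in> Homs C X M" and "e \<cdot> d \<cdot> v = hzero C X D"
    then have "e \<cdot> (d \<cdot> v) = hzero C X D" using Comp_assoc[OF v d e] by simp
    then obtain u where u: "u \<in> Homs C X B" "j \<cdot> u = d \<cdot> v"
      using Confl_lift[OF je j e Comp_Homs[OF v d]] by blast
    \<comment> \<open>Because \<open>j\<close> is monic, the component in \<open>B\<close> is forced
      by the component in \<open>M\<close>; uniqueness in the pullback then becomes uniqueness of a
      factorization through \<open>f'\<close> alone.\<close>
    have "p' \<cdot> w = u" if "w \<in> Homs C X P" "f' \<cdot> w = v" for w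
      using Confl_mono[OF je j Comp_Homs[OF that(1) p'] u(1)] Comp_assoc[OF that(1) p' j]
        Comp_assoc[OF that(1) f' d] sq that(2) u(2) by simp
    then show "\<exists>!w. w \<in> Homs C X P \<and> f' \<cdot> w = v" using univ[OF u(1) v u(2)] by blast
  qed
  then show "M \<in> (\<X> \<star> \<Y>) \<star> \<Z>" using ked k ed D extensions_iff by blast
qed

text \<open>In the opposite category the product reverses its factors, so the reverse inclusion is
  the same lemma with \<open>\<Z>\<close> as the class closed under isomorphisms.\<close>

lemma extensions_assoc:
  assumes "subcategory C \<X>" "subcategory C \<Z>"
  shows "\<X> \<star> (\<Y> \<star> \<Z>) = \<X> \<star> \<Y> \<star> \<Z>"
  using extensions_assoc_subset[OF assms(1)] assms(2)
    exact_category.extensions_assoc_subset[OF exact_opposite, of \<Z> \<Y> \<X>] by simp blast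

end

section \<open>Torsion pairs of full subcategories\<close>

text \<open>
  Torsion pairs of the full exact subcategory on \<open>S\<close>, expressed inside the ambient category:
  the subcategory itself need not be known to be exact.
\<close>

definition torsion_on ::
  "('o, 'm, 'z) exact_data_scheme \<Rightarrow> 'o set \<Rightarrow> 'o set \<Rightarrow> 'o set \<Rightarrow> bool" where
  "torsion_on C S \<T> \<F> \<longleftrightarrow> subcategory C \<T> \<and> subcategory C \<F> \<and> \<T> \<subseteq> S \<and> \<F> \<subseteq> S \<and>
    S \<subseteq> \<T> \<star>\<^bsub>C\<^esub> \<F> \<and> (\<forall>A \<in> \<T>. \<forall>B \<in> \<F>. Homs C A B = {hzero C A B})"

lemma torsion_on_opposite [simp]: "torsion_on (opposite C) S \<F> \<T> = torsion_on C S \<T> \<F>"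
  unfolding torsion_on_def by auto

lemma torsion_pair_iff_torsion_on: "torsion_pair C \<T> \<F> \<longleftrightarrow> torsion_on C (Obj C) \<T> \<F>"
proof -
  have "\<T> \<star>\<^bsub>C\<^esub> \<F> \<subseteq> Obj C" by (auto simp: extensions_def)
  then show ?thesis unfolding torsion_pair_def torsion_on_def by (auto simp: subcategory_def)
qed

lemma Homs_full [simp]:
  "A \<in> S \<Longrightarrow> B \<in> S \<Longrightarrow> Homs (full_exact_subcategory C S) A B = Homs C A B"
  by (auto simp: Homs_def full_exact_subcategory_def)

lemma is_iso_full:
  "is_iso (full_exact_subcategory C S) f \<longleftrightarrow> is_iso C f \<and> Dom C f \<in> S \<and> Cod C f \<in> S"
  by (auto simp: is_iso_def Homs_def full_exact_subcategory_def)

lemma subcategory_full: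
  assumes "subcategory C S"
  shows "subcategory (full_exact_subcategory C S) T \<longleftrightarrow> T \<subseteq> S \<and> subcategory C T"
proof -
  have [simp]: "Obj (full_exact_subcategory C S) = S" "Dom (full_exact_subcategory C S) = Dom C"
    "Cod (full_exact_subcategory C S) = Cod C"
    by (simp_all add: full_exact_subcategory_def)
  show ?thesis using assms unfolding subcategory_def is_iso_full by auto
qed

lemma extensions_full:
  assumes "S \<subseteq> Obj C" "\<X> \<subseteq> S" "\<Y> \<subseteq> S"
  shows "\<X> \<star>\<^bsub>full_exact_subcategory C S\<^esub> \<Y> = S \<inter> (\<X> \<star>\<^bsub>C\<^esub> \<Y>)"
  using assms unfolding extensions_def full_exact_subcategory_def by fastforce

lemma torsion_pair_full_iff_torsion_on:
  assumes "subcategory C S"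
  shows "torsion_pair (full_exact_subcategory C S) \<T> \<F> \<longleftrightarrow> torsion_on C S \<T> \<F>"
proof (cases "\<T> \<subseteq> S \<and> \<F> \<subseteq> S")
  case True
  have "S \<subseteq> Obj C" using assms by (simp add: subcategory_def)
  moreover have "Obj (full_exact_subcategory C S) = S"
    "hzero (full_exact_subcategory C S) = hzero C" by (simp_all add: full_exact_subcategory_def)
  moreover have "Homs (full_exact_subcategory C S) A B = Homs C A B" if "A \<in> \<T>" "B \<in> \<F>" for A B
    using that True by (intro Homs_full) auto
  ultimately show ?thesis
    using True unfolding torsion_pair_def torsion_on_def subcategory_full[OF assms]
    by (auto simp: extensions_full)
next
  case False
  then show ?thesis
    unfolding torsion_pair_def torsion_on_def subcategory_full[OF assms] by blast
qed

context exact_category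
begin

text \<open>If \<open>i\<close> is zero, the identity of \<open>M\<close> factors through the
  cokernel \<open>p\<close>. The resulting left inverse of \<open>p\<close> is also a right inverse
  because \<open>p\<close> is epic, so \<open>M\<close> is isomorphic to \<open>B\<close>.\<close>

lemma Confl_zero_inflation_closed:
  assumes "(i, p) \<in> Confl C" "i \<in> Homs C A M" "p \<in> Homs C M B"
    and "i = hzero C A M" "subcategory C S" "B \<in> S"
  shows "M \<in> S"
proof -
  have M: "M \<in> Obj C" and B: "B \<in> Obj C" using HomsD assms by blast+
  have "Id C M \<cdot> i = hzero C A M" using Comp_Id_left[OF assms(2)] assms(4) by simp
  then obtain g where g: "g \<in> Homs C B M" "g \<cdot> p = Id C M"
    using Confl_colift[OF assms(1-3) Id_Homs[OF M]] by blast
  have "(p \<cdot> g) \<cdot> p = Id C B \<cdot> p"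
    using Comp_assoc[OF assms(3) g(1) assms(3)] g Comp_Id_left[OF assms(3)]
      Comp_Id_right[OF assms(3)] by simp
  then have "p \<cdot> g = Id C B"
    using Confl_epi[OF assms(1,3) Comp_Homs[OF g(1) assms(3)] Id_Homs[OF B]] by blast
  then show ?thesis using subcategory_closed[OF assms(5) g(1) assms(3) _ g(2) assms(6)] by blast
qed

section \<open>Vanishing of arrows along conflations\<close>

lemma Homs_zero_sub:
  assumes "(i, p) \<in> Confl C" "i \<in> Homs C A M" "Homs C X M = {hzero C X M}"
  shows "Homs C X A = {hzero C X A}"
proof (rule Homs_zeroI)
  have "hzero C X M \<in> Homs C X M" using assms(3) by blast
  then show X: "X \<in> Obj C" using HomsD by blast
  show A: "A \<in> Obj C" using HomsD assms by blast
  fix f assume f: "f \<in> Homs C X A"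
  have "i \<cdot> f = i \<cdot> hzero C X A"
    using Comp_Homs[OF f assms(2)] assms(3) Comp_hzero_right[OF assms(2) X] by auto
  then show "f = hzero C X A" using Confl_mono[OF assms(1,2) f hzero_Homs[OF X A]] by blast
qed

lemma Homs_zero_quotient:
  assumes "(i, p) \<in> Confl C" "p \<in> Homs C M B" "Homs C M X = {hzero C M X}"
  shows "Homs C B X = {hzero C B X}"
  using exact_category.Homs_zero_sub[OF exact_opposite, of p i B M X] assms by simp

text \<open>An arrow from \<open>Z\<close> to \<open>M\<close> dies in \<open>B\<close>, hence
  factors through \<open>A\<close>, where it is zero again. Together with \<open>torsion_iff\<close>
  and \<open>torsion_free_iff\<close>, this and its dual replace any separate proof that torsion
  classes are closed under extensions.\<close>

lemma Homs_zero_extension: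
  assumes "M \<in> \<X> \<star> \<Y>" "\<And>A. A \<in> \<X> \<union> \<Y> \<Longrightarrow> Homs C Z A = {hzero C Z A}"
  shows "Homs C Z M = {hzero C Z M}"
proof -
  obtain A B i p where A: "A \<in> \<X>" and B: "B \<in> \<Y>" and ip: "(i, p) \<in> Confl C"
    and i: "i \<in> Homs C A M" and p: "p \<in> Homs C M B"
    using assms(1) by (elim extensionsE)
  have zA: "Homs C Z A = {hzero C Z A}" and zB: "Homs C Z B = {hzero C Z B}"
    using assms(2) A B by blast+
  then have Z: "Z \<in> Obj C" using HomsD by blast
  show ?thesis
  proof (rule Homs_zeroI[OF Z HomsD(2)[OF i]])
    fix f assume f: "f \<in> Homs C Z M"
    have "p \<cdot> f = hzero C Z B" using Comp_Homs[OF f p] zB by blast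
    then obtain g where "g \<in> Homs C Z A" "i \<cdot> g = f" using Confl_lift[OF ip i p f] by blast
    then show "f = hzero C Z M" using zA Comp_hzero_right[OF i Z] by auto
  qed
qed

lemma Homs_zero_coextension:
  assumes "M \<in> \<X> \<star> \<Y>" "\<And>A. A \<in> \<X> \<union> \<Y> \<Longrightarrow> Homs C A Z = {hzero C A Z}"
  shows "Homs C M Z = {hzero C M Z}"
  using exact_category.Homs_zero_extension[OF exact_opposite, of M \<Y> \<X> Z] assms
  by (simp add: Un_commute)

lemma torsion_on_Homs_zero:
  "\<lbrakk>torsion_on C S \<T> \<F>; A \<in> \<T>; B \<in> \<F>\<rbrakk> \<Longrightarrow> Homs C A B = {hzero C A B}"
  unfolding torsion_on_def by blast

lemma torsion_onE:
  assumes "torsion_on C S \<T> \<F>" "M \<in> S"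
  obtains A B i p where "A \<in> \<T>" "B \<in> \<F>" "(i, p) \<in> Confl C" "i \<in> Homs C A M" "p \<in> Homs C M B"
  using assms unfolding torsion_on_def by (blast elim: extensionsE)

text \<open>In the torsion sequence of \<open>M\<close> the inflation from the torsion part vanishes
  by orthogonality, so \<open>M\<close> is isomorphic to its torsion-free quotient.\<close>

lemma torsion_free_iff:
  assumes "torsion_on C S \<T> \<F>" "M \<in> S"
  shows "M \<in> \<F> \<longleftrightarrow> (\<forall>A \<in> \<T>. Homs C A M = {hzero C A M})"
proof
  assume *: "\<forall>A \<in> \<T>. Homs C A M = {hzero C A M}"
  obtain A B i p where "A \<in> \<T>" "B \<in> \<F>" "(i, p) \<in> Confl C" "i \<in> Homs C A M" "p \<in> Homs C M B"
    using assms by (elim torsion_onE)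
  moreover from this have "i = hzero C A M" using * by blast
  ultimately show "M \<in> \<F>"
    using Confl_zero_inflation_closed assms(1) unfolding torsion_on_def by blast
qed (use torsion_on_Homs_zero[OF assms(1)] in blast)

lemma torsion_iff:
  assumes "torsion_on C S \<T> \<F>" "M \<in> S"
  shows "M \<in> \<T> \<longleftrightarrow> (\<forall>B \<in> \<F>. Homs C M B = {hzero C M B})"
  using exact_category.torsion_free_iff[OF exact_opposite, of S \<F> \<T> M] assms by simp

text \<open>Orthogonality to a larger class is a stronger condition. The order on torsion pairs sees
  only first components; this lemma lets equal first components force equal second ones, which gives
  antisymmetry.\<close>

lemma torsion_on_antimono:
  assumes "torsion_on C S \<T> \<F>" "torsion_on C S \<T>' \<F>'" "\<T> \<subseteq> \<T>'"
  shows "\<F>' \<subseteq> \<F>"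
proof
  fix M assume "M \<in> \<F>'"
  moreover from this have "M \<in> S" using assms(2) unfolding torsion_on_def by blast
  ultimately show "M \<in> \<F>" using torsion_free_iff assms by (meson subsetD)
qed

lemma partial_order_tors_full:
  assumes "subcategory C S"
  shows "partial_order (tors (full_exact_subcategory C S))"
  by unfold_locales
    (auto simp: tors_def torsion_pair_full_iff_torsion_on[OF assms]
      intro: subsetD[OF torsion_on_antimono])

text \<open>All arrows into or out of \<open>Z\<close> are zero, so \<open>Z\<close> lies in both
  orthogonals.\<close>

lemma torsion_zero_object:
  assumes "torsion_on C S \<T> \<F>" "is_zero_object C Z" "Z \<in> S"
  shows "Z \<in> \<T>" "Z \<in> \<F>"
proof -
  have Z: "Z \<in> Obj C" and uniq: "\<And>A. A \<in> Obj C \<Longrightarrow> (\<exists>!f. f \<in> Homs C A Z) \<and> (\<exists>!f. f \<in> Homs C Z A)"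
    using assms(2) unfolding is_zero_object_def by blast+
  have sub: "\<And>A. A \<in> \<T> \<union> \<F> \<Longrightarrow> A \<in> Obj C"
    using assms(1) unfolding torsion_on_def subcategory_def by blast
  then have "Homs C A Z = {hzero C A Z}" "Homs C Z A = {hzero C Z A}" if "A \<in> \<T> \<union> \<F>" for A
    using Homs_zeroI uniq hzero_Homs Z that by (metis UnE)+
  then show "Z \<in> \<T>" "Z \<in> \<F>" using torsion_iff torsion_free_iff assms(1,3) by simp_all
qed

text \<open>The axioms make \<open>Id C M\<close> an inflation without naming its cokernel
  \<open>B\<close>. That cokernel is shown to be isomorphic to \<open>Z\<close>, hence to lie in
  \<open>\<Y>\<close>.\<close>

lemma subset_extensions_right:
  assumes "is_zero_object C Z" "Z \<in> \<Y>" "\<X> \<subseteq> Obj C" "subcategory C \<Y>"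
  shows "\<X> \<subseteq> \<X> \<star> \<Y>"
proof
  fix M assume "M \<in> \<X>"
  then have M: "M \<in> Obj C" using assms(3) by blast
  note I = Id_Homs[OF M]
  obtain p where ip: "(Id C M, p) \<in> Confl C" using Id_inflation[OF M] unfolding inflation_def by blast
  then obtain B where p: "p \<in> Homs C M B" using Confl_deflationE I by blast
  have B: "B \<in> Obj C" using HomsD p by blast
  have Z: "Z \<in> Obj C" using assms(1) unfolding is_zero_object_def by blast
  note z1 = hzero_Homs[OF Z B] and z2 = hzero_Homs[OF B Z]
  have "p = hzero C M B" using Confl_Comp[OF ip I p] Comp_Id_right[OF p] by simp
  \<comment> \<open>As \<open>p\<close> is zero and also epic, the identity of \<open>B\<close> is
    zero.\<close>
  then have "Id C B \<cdot> p = hzero C B B \<cdot> p"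
    using Comp_Id_left[OF p] Comp_hzero_left[OF p B] by simp
  then have "Id C B = hzero C B B"
    using Confl_epi[OF ip p Id_Homs[OF B] hzero_Homs[OF B B]] by blast
  then have "hzero C Z B \<cdot> hzero C B Z = Id C B" using Comp_hzero_left[OF z2 B] by simp
  moreover have "hzero C B Z \<cdot> hzero C Z B = Id C Z"
    using assms(1) Comp_Homs[OF z1 z2] Id_Homs[OF Z] Z unfolding is_zero_object_def by blast
  ultimately have "B \<in> \<Y>" using subcategory_closed[OF assms(4) z1 z2 _ _ assms(2)] by blast
  then show "M \<in> \<X> \<star> \<Y>" using ip I p \<open>M \<in> \<X>\<close> extensions_iff by blast
qed

lemma subset_extensions_left:
  assumes "is_zero_object C Z" "Z \<in> \<X>" "\<Y> \<subseteq> Obj C" "subcategory C \<X>"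
  shows "\<Y> \<subseteq> \<X> \<star> \<Y>"
  using exact_category.subset_extensions_right[OF exact_opposite, of Z \<X> \<Y>] assms by simp

end

section \<open>Intervals of torsion pairs\<close>

locale torsion_interval = exact_category C
  for C :: "('o, 'm, 'z) exact_data_scheme" (structure) +
  fixes \<T>\<^sub>1 \<F>\<^sub>1 \<T>\<^sub>2 \<F>\<^sub>2 :: "'o set"
  assumes tors1: "torsion_on C (Obj C) \<T>\<^sub>1 \<F>\<^sub>1"
    and tors2: "torsion_on C (Obj C) \<T>\<^sub>2 \<F>\<^sub>2"
    and T1_T2: "\<T>\<^sub>1 \<subseteq> \<T>\<^sub>2"
begin

lemma F2_F1: "\<F>\<^sub>2 \<subseteq> \<F>\<^sub>1"
  using torsion_on_antimono[OF tors1 tors2 T1_T2] .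

lemma subcategories [simp]:
  "subcategory C \<T>\<^sub>1" "subcategory C \<F>\<^sub>1" "subcategory C \<T>\<^sub>2" "subcategory C \<F>\<^sub>2"
  "subcategory C (\<T>\<^sub>2 \<inter> \<F>\<^sub>1)"
  using tors1 tors2 subcategory_Int unfolding torsion_on_def by blast+

lemma subsets_Obj: "\<T>\<^sub>1 \<subseteq> Obj C" "\<F>\<^sub>1 \<subseteq> Obj C" "\<T>\<^sub>2 \<subseteq> Obj C" "\<F>\<^sub>2 \<subseteq> Obj C"
  using tors1 tors2 unfolding torsion_on_def by blast+

text \<open>Duality swaps the halves of each pair and reverses the interval: the upper pair becomes
  the lower one, and the inclusion required is \<open>\<F>\<^sub>2 \<subseteq> \<F>\<^sub>1\<close>.
  The heart is unchanged.\<close>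

lemma torsion_interval_opposite: "torsion_interval (opposite C) \<F>\<^sub>2 \<T>\<^sub>2 \<F>\<^sub>1 \<T>\<^sub>1"
  unfolding torsion_interval_def torsion_interval_axioms_def
  using exact_opposite tors1 tors2 F2_F1 by simp

text \<open>The torsion sequence of an object of the heart, taken in the ambient category, already
  has its terms in the heart: \<open>\<F>\<^sub>1\<close> passes to the subobject and
  \<open>\<T>\<^sub>2\<close> to the quotient, both by orthogonality.\<close>

lemma torsion_on_restrict:
  assumes TF: "torsion_on C (Obj C) \<T> \<F>" and "\<T>\<^sub>1 \<subseteq> \<T>" "\<T> \<subseteq> \<T>\<^sub>2"
  shows "torsion_on C (\<T>\<^sub>2 \<inter> \<F>\<^sub>1) (\<T> \<inter> \<F>\<^sub>1) (\<T>\<^sub>2 \<inter> \<F>)"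
proof -
  have "\<F> \<subseteq> \<F>\<^sub>1" using torsion_on_antimono[OF tors1 TF assms(2)] .
  moreover have "M \<in> (\<T> \<inter> \<F>\<^sub>1) \<star> (\<T>\<^sub>2 \<inter> \<F>)" if M: "M \<in> \<T>\<^sub>2" "M \<in> \<F>\<^sub>1" for M
  proof -
    have "M \<in> Obj C" using M subsets_Obj by blast
    then obtain A B i p where A: "A \<in> \<T>" and B: "B \<in> \<F>" and ip: "(i, p) \<in> Confl C"
      and i: "i \<in> Homs C A M" and p: "p \<in> Homs C M B"
      using TF by (elim torsion_onE)
    have "A \<in> \<F>\<^sub>1"
      using torsion_free_iff[OF tors1 HomsD(1)[OF i]] Homs_zero_sub[OF ip i]
        torsion_on_Homs_zero[OF tors1 _ M(2)] by blast
    moreover have "B \<in> \<T>\<^sub>2"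
      using torsion_iff[OF tors2 HomsD(2)[OF p]] Homs_zero_quotient[OF ip p]
        torsion_on_Homs_zero[OF tors2 M(1)] by blast
    ultimately show ?thesis using A B ip i p extensions_iff by blast
  qed
  ultimately show ?thesis
    using TF assms(3) subcategory_Int subcategories unfolding torsion_on_def by blast
qed

lemma zero_objectE:
  obtains Z where "is_zero_object C Z" "Z \<in> \<T>\<^sub>1" "Z \<in> \<F>\<^sub>1" "Z \<in> \<T>\<^sub>2" "Z \<in> \<F>\<^sub>2"
proof -
  obtain Z where Z: "is_zero_object C Z" using zero_object by blast
  then have "Z \<in> Obj C" unfolding is_zero_object_def by blast
  then show thesis using that[OF Z] torsion_zero_object[OF _ Z] tors1 tors2 by blast
qed

lemma torsion_on_extend:
  assumes XY: "torsion_on C (\<T>\<^sub>2 \<inter> \<F>\<^sub>1) \<X> \<Y>"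
  shows "torsion_on C (Obj C) (\<T>\<^sub>1 \<star> \<X>) (\<Y> \<star> \<F>\<^sub>2)"
proof -
  have X: "\<X> \<subseteq> \<T>\<^sub>2" "subcategory C \<X>" and Y: "\<Y> \<subseteq> \<F>\<^sub>1" "subcategory C \<Y>"
    and S: "\<T>\<^sub>2 \<inter> \<F>\<^sub>1 \<subseteq> \<X> \<star> \<Y>"
    using XY unfolding torsion_on_def by blast+
  have "Homs C M N = {hzero C M N}" if M: "M \<in> \<T>\<^sub>1 \<star> \<X>" and N: "N \<in> \<Y> \<star> \<F>\<^sub>2" for M N
  proof (rule Homs_zero_coextension[OF M], rule Homs_zero_extension[OF N])
    fix A B assume "A \<in> \<T>\<^sub>1 \<union> \<X>" "B \<in> \<Y> \<union> \<F>\<^sub>2"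
    \<comment> \<open>Of the four combinations, the two with \<open>\<T>\<^sub>1\<close> merge
      because \<open>\<Y>\<close> and \<open>\<F>\<^sub>2\<close> both lie in
      \<open>\<F>\<^sub>1\<close>; the combination of \<open>\<X>\<close> with
      \<open>\<F>\<^sub>2\<close> is covered by
      \<open>\<X> \<subseteq> \<T>\<^sub>2\<close>.\<close>
    then consider "A \<in> \<T>\<^sub>1" "B \<in> \<F>\<^sub>1" | "A \<in> \<X>" "B \<in> \<Y>" | "A \<in> \<T>\<^sub>2" "B \<in> \<F>\<^sub>2"
      using X Y F2_F1 by blast
    then show "Homs C A B = {hzero C A B}"
      using torsion_on_Homs_zero[OF tors1] torsion_on_Homs_zero[OF XY]
        torsion_on_Homs_zero[OF tors2] by cases
  qed
  moreover have "Obj C \<subseteq> (\<T>\<^sub>1 \<star> \<X>) \<star> (\<Y> \<star> \<F>\<^sub>2)"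
  proof -
    have "M \<in> \<T>\<^sub>1 \<star> (\<T>\<^sub>2 \<inter> \<F>\<^sub>1)" if "M \<in> \<T>\<^sub>2" for M
    proof -
      have "M \<in> Obj C" using that subsets_Obj by blast
      then obtain A B i p where A: "A \<in> \<T>\<^sub>1" and B: "B \<in> \<F>\<^sub>1" and ip: "(i, p) \<in> Confl C"
        and i: "i \<in> Homs C A M" and p: "p \<in> Homs C M B"
        using tors1 by (elim torsion_onE)
      have "B \<in> \<T>\<^sub>2"
        using torsion_iff[OF tors2 HomsD(2)[OF p]] Homs_zero_quotient[OF ip p]
          torsion_on_Homs_zero[OF tors2 that] by blast
      then show ?thesis using A B ip i p extensions_iff by blast
    qed
    then have "\<T>\<^sub>2 \<subseteq> \<T>\<^sub>1 \<star> (\<X> \<star> \<Y>)" using extensions_mono[OF order_refl S] by blast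
    also have "\<dots> \<subseteq> (\<T>\<^sub>1 \<star> \<X>) \<star> \<Y>" using extensions_assoc_subset by simp
    finally have "\<T>\<^sub>2 \<star> \<F>\<^sub>2 \<subseteq> (\<T>\<^sub>1 \<star> \<X>) \<star> \<Y> \<star> \<F>\<^sub>2" by (rule extensions_mono) simp
    \<comment> \<open>The leftmost factor is now the whole class
      \<open>\<T>\<^sub>1 \<star> \<X>\<close>, closed under isomorphisms because it is a class of
      extensions.\<close>
    also have "\<dots> = (\<T>\<^sub>1 \<star> \<X>) \<star> (\<Y> \<star> \<F>\<^sub>2)"
      using extensions_assoc[OF subcategory_extensions] by simp
    finally show ?thesis using tors2 unfolding torsion_on_def by blast
  qed
  ultimately show ?thesis
    using subcategory_extensions unfolding torsion_on_def by (auto simp: extensions_def)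
qed

text \<open>The lower bound uses a zero object in \<open>\<X>\<close>, the upper one that
  \<open>\<T>\<^sub>2\<close> is an orthogonal class and so contains extensions of its
  members.\<close>

lemma extend_bounds:
  assumes XY: "torsion_on C (\<T>\<^sub>2 \<inter> \<F>\<^sub>1) \<X> \<Y>"
  shows "\<T>\<^sub>1 \<subseteq> \<T>\<^sub>1 \<star> \<X>" "\<T>\<^sub>1 \<star> \<X> \<subseteq> \<T>\<^sub>2"
proof -
  have X: "\<X> \<subseteq> \<T>\<^sub>2" "subcategory C \<X>" using XY unfolding torsion_on_def by blast+
  obtain Z where Z: "is_zero_object C Z" "Z \<in> \<F>\<^sub>1" "Z \<in> \<T>\<^sub>2" by (rule zero_objectE)
  then have "Z \<in> \<X>" using torsion_zero_object[OF XY] by blast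
  then show "\<T>\<^sub>1 \<subseteq> \<T>\<^sub>1 \<star> \<X>" using subset_extensions_right Z X subsets_Obj by blast
  show "\<T>\<^sub>1 \<star> \<X> \<subseteq> \<T>\<^sub>2"
  proof
    fix M assume M: "M \<in> \<T>\<^sub>1 \<star> \<X>"
    then have "M \<in> Obj C" by (simp add: extensions_def)
    then show "M \<in> \<T>\<^sub>2"
      using torsion_iff[OF tors2] Homs_zero_coextension[OF M] torsion_on_Homs_zero[OF tors2] T1_T2 X
      by (meson UnE subsetD)
  qed
qed

text \<open>The torsion half of \<Psi> after \<Phi>. An extension of members of \<open>\<T>\<close>
  stays in \<open>\<T>\<close>; conversely, splitting \<open>M\<close> in \<open>\<T>\<close> by the
  first pair leaves a quotient that is again in \<open>\<T>\<close>.\<close>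

lemma torsion_part_extend_restrict:
  assumes TF: "torsion_on C (Obj C) \<T> \<F>" and "\<T>\<^sub>1 \<subseteq> \<T>"
  shows "\<T>\<^sub>1 \<star> (\<T> \<inter> \<F>\<^sub>1) = \<T>"
proof (intro subset_antisym subsetI)
  fix M assume M: "M \<in> \<T>\<^sub>1 \<star> (\<T> \<inter> \<F>\<^sub>1)"
  then have "M \<in> Obj C" by (simp add: extensions_def)
  then show "M \<in> \<T>"
    using torsion_iff[OF TF] Homs_zero_coextension[OF M] torsion_on_Homs_zero[OF TF] assms(2)
    by (meson IntD1 UnE subsetD)
next
  fix M assume M: "M \<in> \<T>"
  then have "M \<in> Obj C" using TF unfolding torsion_on_def by blast
  then obtain A B i p where A: "A \<in> \<T>\<^sub>1" and B: "B \<in> \<F>\<^sub>1" and ip: "(i, p) \<in> Confl C"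
    and i: "i \<in> Homs C A M" and p: "p \<in> Homs C M B"
    using tors1 by (elim torsion_onE)
  have "B \<in> \<T>"
    using torsion_iff[OF TF HomsD(2)[OF p]] Homs_zero_quotient[OF ip p]
      torsion_on_Homs_zero[OF TF M] by blast
  then show "M \<in> \<T>\<^sub>1 \<star> (\<T> \<inter> \<F>\<^sub>1)" using A B ip i p extensions_iff by blast
qed

lemma torsion_free_part_extend_restrict:
  assumes "torsion_on C (Obj C) \<T> \<F>" and "\<T> \<subseteq> \<T>\<^sub>2"
  shows "(\<T>\<^sub>2 \<inter> \<F>) \<star> \<F>\<^sub>2 = \<F>"
  using torsion_interval.torsion_part_extend_restrict[OF torsion_interval_opposite, of \<F> \<T>]
    assms torsion_on_antimono[OF assms(1) tors2] by (simp add: Int_commute)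

text \<open>The torsion half of \<Phi> after \<Psi>. If \<open>M\<close> lies in
  \<open>\<F>\<^sub>1\<close>, its subobject from \<open>\<T>\<^sub>1\<close> includes by the zero
  arrow, so \<open>M\<close> is isomorphic to the quotient in \<open>\<X>\<close>. Conversely, a
  zero object in \<open>\<T>\<^sub>1\<close> exhibits \<open>M\<close> as a trivial
  extension.\<close>

lemma torsion_part_restrict_extend:
  assumes XY: "torsion_on C (\<T>\<^sub>2 \<inter> \<F>\<^sub>1) \<X> \<Y>"
  shows "(\<T>\<^sub>1 \<star> \<X>) \<inter> \<F>\<^sub>1 = \<X>"
proof (intro subset_antisym subsetI)
  have X: "\<X> \<subseteq> \<T>\<^sub>2 \<inter> \<F>\<^sub>1" "subcategory C \<X>" using XY unfolding torsion_on_def by blast+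
  {
    fix M assume "M \<in> (\<T>\<^sub>1 \<star> \<X>) \<inter> \<F>\<^sub>1"
    then obtain A B i p where A: "A \<in> \<T>\<^sub>1" and B: "B \<in> \<X>" and ip: "(i, p) \<in> Confl C"
      and i: "i \<in> Homs C A M" and p: "p \<in> Homs C M B" and M: "M \<in> \<F>\<^sub>1"
      by (auto elim: extensionsE)
    then show "M \<in> \<X>"
      using Confl_zero_inflation_closed[OF ip i p _ X(2)] torsion_on_Homs_zero[OF tors1 A M] by blast
  next
    fix M assume M: "M \<in> \<X>"
    obtain Z where "is_zero_object C Z" "Z \<in> \<T>\<^sub>1" by (rule zero_objectE)
    moreover have "\<X> \<subseteq> Obj C" using X subsets_Obj by blast
    ultimately show "M \<in> (\<T>\<^sub>1 \<star> \<X>) \<inter> \<F>\<^sub>1"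
      using subset_extensions_left[of Z \<T>\<^sub>1 \<X>] X M by auto
  }
qed

lemma torsion_free_part_restrict_extend:
  assumes "torsion_on C (\<T>\<^sub>2 \<inter> \<F>\<^sub>1) \<X> \<Y>"
  shows "\<T>\<^sub>2 \<inter> (\<Y> \<star> \<F>\<^sub>2) = \<Y>"
  using torsion_interval.torsion_part_restrict_extend[OF torsion_interval_opposite, of \<Y> \<X>] assms
  by (simp add: Int_commute)

end

text \<open>Reflection of the order by \<open>f\<close> is monotonicity of \<open>g\<close> applied
  to \<open>f x\<close> and \<open>f x'\<close>.\<close>

lemma poset_isomorphism_inverse:
  assumes "partial_order P" "partial_order Q"
    and f: "\<And>x. x \<in> carrier P \<Longrightarrow> f x \<in> carrier Q \<and> g (f x) = x"
    and g: "\<And>y. y \<in> carrier Q \<Longrightarrow> g y \<in> carrier P \<and> f (g y) = y"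
    and f_mono: "\<And>x x'. \<lbrakk>x \<in> carrier P; x' \<in> carrier P; x \<sqsubseteq>\<^bsub>P\<^esub> x'\<rbrakk> \<Longrightarrow> f x \<sqsubseteq>\<^bsub>Q\<^esub> f x'"
    and g_mono: "\<And>y y'. \<lbrakk>y \<in> carrier Q; y' \<in> carrier Q; y \<sqsubseteq>\<^bsub>Q\<^esub> y'\<rbrakk> \<Longrightarrow> g y \<sqsubseteq>\<^bsub>P\<^esub> g y'"
  shows "poset_isomorphism P Q f"
  unfolding poset_isomorphism_def
proof (intro conjI ballI assms(1,2))
  show "bij_betw f (carrier P) (carrier Q)" using f g by (intro bij_betw_byWitness[of _ g]) auto
  show "x \<sqsubseteq>\<^bsub>P\<^esub> x' \<longleftrightarrow> f x \<sqsubseteq>\<^bsub>Q\<^esub> f x'" if "x \<in> carrier P" "x' \<in> carrier P" for x x'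
    using that f f_mono g_mono[of "f x" "f x'"] by auto
qed

lemma (in exact_category) partial_order_tors_interval: "partial_order (tors_interval C x y)"
  by unfold_locales
    (auto simp: tors_interval_def tors_def torsion_pair_iff_torsion_on
      intro: subsetD[OF torsion_on_antimono])

theorem corollary3p15:
  fixes E :: "('o, 'm, 'z) exact_data_scheme"
    and \<T>\<^sub>1 \<F>\<^sub>1 \<T>\<^sub>2 \<F>\<^sub>2 :: "'o set"
  assumes "exact_category E"
    and "torsion_pair E \<T>\<^sub>1 \<F>\<^sub>1"
    and "torsion_pair E \<T>\<^sub>2 \<F>\<^sub>2"
    and "\<T>\<^sub>1 \<subseteq> \<T>\<^sub>2"
  shows "let \<H> = full_exact_subcategory E (\<T>\<^sub>2 \<inter> \<F>\<^sub>1);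
             I = tors_interval E (\<T>\<^sub>1, \<F>\<^sub>1) (\<T>\<^sub>2, \<F>\<^sub>2);
             \<Phi> = (\<lambda>(\<T>, \<F>). (\<T> \<inter> \<F>\<^sub>1, \<T>\<^sub>2 \<inter> \<F>));
             \<Psi> = (\<lambda>(\<X>, \<Y>). (\<T>\<^sub>1 \<star>\<^bsub>E\<^esub> \<X>, \<Y> \<star>\<^bsub>E\<^esub> \<F>\<^sub>2))
         in poset_isomorphism I (tors \<H>) \<Phi> \<and>
            poset_isomorphism (tors \<H>) I \<Psi> \<and>
            (\<forall>x \<in> carrier I. \<Psi> (\<Phi> x) = x) \<and>
            (\<forall>y \<in> carrier (tors \<H>). \<Phi> (\<Psi> y) = y)"
proof -
  interpret torsion_interval E \<T>\<^sub>1 \<F>\<^sub>1 \<T>\<^sub>2 \<F>\<^sub>2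
    using assms unfolding torsion_interval_def torsion_interval_axioms_def
    by (simp add: torsion_pair_iff_torsion_on)
  define \<H> where "\<H> = full_exact_subcategory E (\<T>\<^sub>2 \<inter> \<F>\<^sub>1)"
  define I where "I = tors_interval E (\<T>\<^sub>1, \<F>\<^sub>1) (\<T>\<^sub>2, \<F>\<^sub>2)"
  define \<Phi> where "\<Phi> = (\<lambda>(\<T>, \<F>). (\<T> \<inter> \<F>\<^sub>1, \<T>\<^sub>2 \<inter> \<F>))"
  define \<Psi> where "\<Psi> = (\<lambda>(\<X>, \<Y>). (\<T>\<^sub>1 \<star>\<^bsub>E\<^esub> \<X>, \<Y> \<star>\<^bsub>E\<^esub> \<F>\<^sub>2))"
  have carrier_I: "(\<T>, \<F>) \<in> carrier I \<longleftrightarrow>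
      torsion_on E (Obj E) \<T> \<F> \<and> \<T>\<^sub>1 \<subseteq> \<T> \<and> \<T> \<subseteq> \<T>\<^sub>2" for \<T> \<F>
    by (simp add: I_def tors_interval_def tors_def torsion_pair_iff_torsion_on)
  have carrier_H: "(\<X>, \<Y>) \<in> carrier (tors \<H>) \<longleftrightarrow> torsion_on E (\<T>\<^sub>2 \<inter> \<F>\<^sub>1) \<X> \<Y>" for \<X> \<Y>
    by (simp add: \<H>_def tors_def torsion_pair_full_iff_torsion_on)
  \<comment> \<open>Both orders compare first components only, so monotonicity concerns just
    intersecting with \<open>\<F>\<^sub>1\<close> and extending by
    \<open>\<T>\<^sub>1\<close>.\<close>
  have le: "x \<sqsubseteq>\<^bsub>I\<^esub> y \<longleftrightarrow> fst x \<subseteq> fst y" "x \<sqsubseteq>\<^bsub>tors \<H>\<^esub> y \<longleftrightarrow> fst x \<subseteq> fst y" for x y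
    by (simp_all add: I_def tors_interval_def tors_def)
  have \<Phi>: "\<Phi> x \<in> carrier (tors \<H>) \<and> \<Psi> (\<Phi> x) = x" if "x \<in> carrier I" for x
  proof -
    obtain \<T> \<F> where "x = (\<T>, \<F>)" by fastforce
    then show ?thesis
      using that torsion_on_restrict[of \<T> \<F>] torsion_part_extend_restrict[of \<T> \<F>]
        torsion_free_part_extend_restrict[of \<T> \<F>]
      by (simp add: carrier_I carrier_H \<Phi>_def \<Psi>_def)
  qed
  have \<Psi>: "\<Psi> y \<in> carrier I \<and> \<Phi> (\<Psi> y) = y" if "y \<in> carrier (tors \<H>)" for y
  proof -
    obtain \<X> \<Y> where "y = (\<X>, \<Y>)" by fastforce
    then show ?thesis
      using that torsion_on_extend[of \<X> \<Y>] extend_bounds[of \<X> \<Y>]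
        torsion_part_restrict_extend[of \<X> \<Y>] torsion_free_part_restrict_extend[of \<X> \<Y>]
      by (simp add: carrier_I carrier_H \<Phi>_def \<Psi>_def)
  qed
  have \<Phi>_mono: "\<Phi> x \<sqsubseteq>\<^bsub>tors \<H>\<^esub> \<Phi> x'" if "x \<sqsubseteq>\<^bsub>I\<^esub> x'" for x x'
    using that unfolding le \<Phi>_def by (auto simp: case_prod_unfold)
  have \<Psi>_mono: "\<Psi> y \<sqsubseteq>\<^bsub>I\<^esub> \<Psi> y'" if "y \<sqsubseteq>\<^bsub>tors \<H>\<^esub> y'" for y y'
    using that extensions_mono[OF order_refl] unfolding le \<Psi>_def by (simp add: case_prod_unfold)
  have "partial_order I" "partial_order (tors \<H>)"
    unfolding I_def \<H>_def using partial_order_tors_interval partial_order_tors_full by simp_all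
  then have "poset_isomorphism I (tors \<H>) \<Phi>" "poset_isomorphism (tors \<H>) I \<Psi>"
    using \<Phi> \<Psi> \<Phi>_mono \<Psi>_mono
    by (auto intro!: poset_isomorphism_inverse[where f = \<Phi> and g = \<Psi>]
        poset_isomorphism_inverse[where f = \<Psi> and g = \<Phi>])
  then show ?thesis
    using \<Phi> \<Psi> unfolding Let_def \<H>_def I_def \<Phi>_def \<Psi>_def by blast
qed

end
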